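(* Let $a_0\in\mathbb{R}$ and consider, for $(x,y)\in[0,1]^2$, the equation $$u_t=\det(D^2u)-\Delta^2u$$ subject to the boundary conditions $$\partial_x^3u(0,y,t)=\partial_x^3u(1,y,t)=\partial_y^3u(x,0,t)=\partial_y^3u(x,1,t)=0,$$ $$\partial_xu(0,y,t)=\partial_yu(x,0,t)=0,\qquad \partial_xu(1,y,t)=\partial_x^2u(1,y,t),\qquad \partial_yu(x,1,t)=\partial_y^2u(x,1,t).$$ This problem admits the explicit solution $$u(x,y,t)=\frac{a_0}{1+12a_0t}\,x^2y^2-\frac23\ln(1+12a_0t),$$ for $t\ge0$ with $1+12a_0t>0$. Moreover: (i) if $a_0=0$, then $u\equiv0$ for all times; (ii) if $a_0>0$, then the solution exists for all $t\ge0$ and blows up in infinite time, with $\lim_{t\nearrow\infty}u(x,y,t)=-\infty$ for all $(x,y)\in[0,1]^2$; (iii) if $a_0<0$, then the solution blows up in finite time at $T^*=\frac{-1}{12a_0}$, with $\lim_{t\nearrow T^*}u(x,y,t)=+\infty$ for all $(x,y)\in[0,1]^2$ with $x=0$ or $y=0$, and $\lim_{t\nearrow T^*}u(x,y,t)=-\infty$ for all other $(x,y)\in[0,1]^2$. In particular, in cases (ii) and (iii) the blow-up is complete.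
   Context: Here $u=u(x,y,t)$ is real valued, $D^2u$ is the Hessian matrix with respect to the spatial variables $(x,y)$, so that $\det(D^2u)=u_{xx}u_{yy}-u_{xy}^2$, and $\Delta^2u=u_{xxxx}+2u_{xxyy}+u_{yyyy}$. "Solution" means that the (smooth) function satisfies the equation and the boundary conditions pointwise. Blow-up at a time $T^*\in(0,\infty]$ is complete if $|u(x,y,t)|\to\infty$ as $t\nearrow T^*$ at every point $(x,y)$ of the spatial domain. *)

theory Defs
  imports "HOL-Analysis.Analysis"
begin

text \<open>
  Functions \<open>u x y t\<close> live on the closed square times a time interval \<open>J\<close>. Derivatives are taken
  within this domain, so they are one-sided at boundary points, and they carry no information
  outside of it.
\<close>

definition dx :: "(real \<Rightarrow> real \<Rightarrow> real \<Rightarrow> real) \<Rightarrow> real \<Rightarrow> real \<Rightarrow> real \<Rightarrow> real" where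
  "dx u = (\<lambda>x y t. vector_derivative (\<lambda>s. u s y t) (at x within {0..1}))"

definition dy :: "(real \<Rightarrow> real \<Rightarrow> real \<Rightarrow> real) \<Rightarrow> real \<Rightarrow> real \<Rightarrow> real \<Rightarrow> real" where
  "dy u = (\<lambda>x y t. vector_derivative (\<lambda>s. u x s t) (at y within {0..1}))"

definition dt :: "real set \<Rightarrow> (real \<Rightarrow> real \<Rightarrow> real \<Rightarrow> real) \<Rightarrow> real \<Rightarrow> real \<Rightarrow> real \<Rightarrow> real" where
  "dt J u = (\<lambda>x y t. vector_derivative (\<lambda>s. u x y s) (at t within J))"

definition hessian :: "(real \<Rightarrow> real \<Rightarrow> real \<Rightarrow> real) \<Rightarrow> real \<Rightarrow> real \<Rightarrow> real \<Rightarrow> real ^ 2 ^ 2" where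
  "hessian u x y t =
     vector [vector [dx (dx u) x y t, dx (dy u) x y t],
             vector [dy (dx u) x y t, dy (dy u) x y t]]"

definition bilaplacian :: "(real \<Rightarrow> real \<Rightarrow> real \<Rightarrow> real) \<Rightarrow> real \<Rightarrow> real \<Rightarrow> real \<Rightarrow> real" where
  "bilaplacian u x y t =
     (dx ^^ 4) u x y t + 2 * dy (dy (dx (dx u))) x y t + (dy ^^ 4) u x y t"

text \<open>
  \<open>Ck J k u\<close>: all iterated partial derivatives of \<open>u\<close> of order at most \<open>k\<close>, in any order of
  differentiation, exist and are continuous up to the boundary.
\<close>

primrec Ck :: "real set \<Rightarrow> nat \<Rightarrow> (real \<Rightarrow> real \<Rightarrow> real \<Rightarrow> real) \<Rightarrow> bool" where
  "Ck J 0 u \<longleftrightarrow> continuous_on ({0..1} \<times> {0..1} \<times> J) (\<lambda>(x, y, t). u x y t)"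
| "Ck J (Suc k) u \<longleftrightarrow>
     continuous_on ({0..1} \<times> {0..1} \<times> J) (\<lambda>(x, y, t). u x y t) \<and>
     (\<forall>x\<in>{0..1}. \<forall>y\<in>{0..1}. \<forall>t\<in>J.
        (\<lambda>s. u s y t) differentiable (at x within {0..1}) \<and>
        (\<lambda>s. u x s t) differentiable (at y within {0..1}) \<and>
        (\<lambda>s. u x y s) differentiable (at t within J)) \<and>
     Ck J k (dx u) \<and> Ck J k (dy u) \<and> Ck J k (dt J u)"

definition smooth :: "real set \<Rightarrow> (real \<Rightarrow> real \<Rightarrow> real \<Rightarrow> real) \<Rightarrow> bool" where
  "smooth J u \<longleftrightarrow> (\<forall>k. Ck J k u)"

definition boundary_conditions :: "real set \<Rightarrow> (real \<Rightarrow> real \<Rightarrow> real \<Rightarrow> real) \<Rightarrow> bool" where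
  "boundary_conditions J u \<longleftrightarrow>
     (\<forall>t\<in>J.
       (\<forall>y\<in>{0..1}.
          (dx ^^ 3) u 0 y t = 0 \<and> (dx ^^ 3) u 1 y t = 0 \<and>
          dx u 0 y t = 0 \<and> dx u 1 y t = (dx ^^ 2) u 1 y t) \<and>
       (\<forall>x\<in>{0..1}.
          (dy ^^ 3) u x 0 t = 0 \<and> (dy ^^ 3) u x 1 t = 0 \<and>
          dy u x 0 t = 0 \<and> dy u x 1 t = (dy ^^ 2) u x 1 t))"

definition solution_on :: "real set \<Rightarrow> (real \<Rightarrow> real \<Rightarrow> real \<Rightarrow> real) \<Rightarrow> bool" where
  "solution_on J u \<longleftrightarrow>
     smooth J u \<and>
     (\<forall>x\<in>{0..1}. \<forall>y\<in>{0..1}. \<forall>t\<in>J.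
        dt J u x y t = det (hessian u x y t) - bilaplacian u x y t) \<and>
     boundary_conditions J u"

text \<open>The filter of times increasing to \<open>T\<close>, where \<open>T\<close> may be infinite.\<close>

definition upto_time :: "ereal \<Rightarrow> real filter" where
  "upto_time T = (if T = \<infinity> then at_top else at_left (real_of_ereal T))"

text \<open>
  Blow-up at \<open>T\<close>: a solution on \<open>[0, T)\<close> whose maximum norm over the square tends to infinity.
  The supremum is taken in the extended reals, so that it is always meaningful.
\<close>

definition blows_up_at :: "ereal \<Rightarrow> (real \<Rightarrow> real \<Rightarrow> real \<Rightarrow> real) \<Rightarrow> bool" where
  "blows_up_at T u \<longleftrightarrow>
     0 < T \<and> solution_on {t. 0 \<le> t \<and> ereal t < T} u \<and>
     ((\<lambda>t. SUP (x, y)\<in>{0..1} \<times> {0..1}. ereal \<bar>u x y t\<bar>) \<longlongrightarrow> \<infinity>) (upto_time T)"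

definition complete_blow_up_at :: "ereal \<Rightarrow> (real \<Rightarrow> real \<Rightarrow> real \<Rightarrow> real) \<Rightarrow> bool" where
  "complete_blow_up_at T u \<longleftrightarrow>
     blows_up_at T u \<and>
     (\<forall>x\<in>{0..1}. \<forall>y\<in>{0..1}. filterlim (\<lambda>t. \<bar>u x y t\<bar>) at_top (upto_time T))"

end

theory Submission
  imports Defs "HOL-Real_Asymp.Real_Asymp"
begin

text \<open>
  With \<open>c(t) = a\<^sub>0 / (1 + 12 a\<^sub>0 t)\<close> the function is \<open>u = c x\<^sup>2 y\<^sup>2 - 2/3 ln (1 + 12 a\<^sub>0 t)\<close>, and
  \<^item> \<open>det (D\<^sup>2 u) = (2 c y\<^sup>2) (2 c x\<^sup>2) - (4 c x y)\<^sup>2 = - 12 c\<^sup>2 x\<^sup>2 y\<^sup>2\<close>,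
  \<^item> \<open>\<Delta>\<^sup>2 u = 2 u\<^bsub>xxyy\<^esub> = 8 c\<close>,
  \<^item> \<open>u\<^sub>t = c' x\<^sup>2 y\<^sup>2 - 8 c\<close> where \<open>c' = - 12 c\<^sup>2\<close>.

  So the equation holds. In each spatial variable separately \<open>u\<close> has the form \<open>\<alpha> s\<^sup>2 + \<beta>\<close>, whose first
  derivative vanishes at \<open>0\<close>, whose first and second derivatives agree at \<open>1\<close>, and whose third
  derivative is \<open>0\<close>; these are the boundary conditions (\<open>explicit_solution\<close>). Smoothness up to the boundary holds
  because \<open>u\<close> belongs to a class of functions that are continuous on the domain and that is closed
  under all three partial derivatives (\<open>Ck_elementary\<close>).

  The blow-up is read off from \<open>u = k / w - 2/3 ln w\<close> where \<open>w = 1 + 12 a\<^sub>0 t\<close> and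
  \<open>k = a\<^sub>0 x\<^sup>2 y\<^sup>2\<close>. If \<open>a\<^sub>0 > 0\<close>, then \<open>w \<rightarrow> \<infinity>\<close> and the logarithm wins. If \<open>a\<^sub>0 < 0\<close>, then \<open>w\<close>
  decreases to \<open>0\<close>: the logarithm is all there is when \<open>x y = 0\<close>, and otherwise the negative term
  \<open>k / w\<close> dominates it. Divergence at a single point forces the maximum norm to diverge
  (\<open>blows_up_at_if_pointwise\<close>).
\<close>

section \<open>Partial derivatives within the domain\<close>

lemma has_real_derivative_within_cong:
  fixes f g :: "real \<Rightarrow> real"
  assumes "(f has_real_derivative d) (at x within S)" "x \<in> S" "\<And>s. s \<in> S \<Longrightarrow> g s = f s"
  shows "(g has_real_derivative d) (at x within S)"
  using assms has_vector_derivative_transform[of x S g f d]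
  by (simp add: has_real_derivative_iff_has_vector_derivative)

text \<open>
  The limit point assumption makes the derivative within \<open>S\<close> unique. The function \<open>g\<close> only has to
  agree with \<open>f\<close> on \<open>S\<close>, so that iterated derivatives, which can be unspecified outside of
  the domain, can be computed one after the other.
\<close>

lemma vector_derivative_within_eqI:
  fixes f g :: "real \<Rightarrow> real"
  assumes "(f has_real_derivative d) (at x within S)" "x \<in> S" "x islimpt S"
    and "\<And>s. s \<in> S \<Longrightarrow> g s = f s"
  shows "vector_derivative g (at x within S) = d"
proof -
  have "(g has_real_derivative d) (at x within S)"
    by (rule has_real_derivative_within_cong[OF assms(1,2,4)])
  then have "(g has_vector_derivative d) (at x within S)"
    by (simp add: has_real_derivative_iff_has_vector_derivative)
  moreover have "at x within S \<noteq> bot"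
    using assms(3) trivial_limit_within by blast
  ultimately show ?thesis
    by (simp add: vector_derivative_within)
qed

lemma connected_imp_islimpt:
  fixes x :: "'a::metric_space"
  assumes "connected S" "x \<in> S" "p \<in> S" "q \<in> S" "p \<noteq> q"
  shows "x islimpt S"
  using assms by (intro connected_imp_perfect) auto

lemma islimpt_unit_interval:
  fixes x :: real
  assumes "x \<in> {0..1}"
  shows "x islimpt {0..1}"
  by (rule connected_imp_islimpt[where p = 0 and q = 1]) (use assms in auto)

lemma dx_eqI:
  assumes "\<And>s. s \<in> {0..1} \<Longrightarrow> u s y t = f s"
    and "(f has_real_derivative d) (at x within {0..1})" "x \<in> {0..1}"
  shows "dx u x y t = d"
  unfolding dx_def using assms islimpt_unit_interval by (intro vector_derivative_within_eqI) auto

lemma dy_eqI: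
  assumes "\<And>s. s \<in> {0..1} \<Longrightarrow> u x s t = f s"
    and "(f has_real_derivative d) (at y within {0..1})" "y \<in> {0..1}"
  shows "dy u x y t = d"
  unfolding dy_def using assms islimpt_unit_interval by (intro vector_derivative_within_eqI) auto

lemma dt_eqI:
  assumes "\<And>s. s \<in> J \<Longrightarrow> u x y s = f s"
    and "(f has_real_derivative d) (at t within J)" "t \<in> J" "t islimpt J"
  shows "dt J u x y t = d"
  unfolding dt_def using assms by (intro vector_derivative_within_eqI) auto

section \<open>Smoothness\<close>

text \<open>
  The functions built from constants, \<open>x\<close>, \<open>y\<close>, \<open>1 / (1 + b t)\<close> and \<open>ln (1 + b t)\<close> by sums and
  products. What matters is that every partial derivative of such a function is again of this kind.
\<close>

inductive elementary :: "real \<Rightarrow> (real \<Rightarrow> real \<Rightarrow> real \<Rightarrow> real) \<Rightarrow> bool" for b where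
  const: "elementary b (\<lambda>x y t. c)"
| x: "elementary b (\<lambda>x y t. x)"
| y: "elementary b (\<lambda>x y t. y)"
| inverse: "elementary b (\<lambda>x y t. inverse (1 + b * t))"
| ln: "elementary b (\<lambda>x y t. ln (1 + b * t))"
| add: "elementary b f \<Longrightarrow> elementary b g \<Longrightarrow> elementary b (\<lambda>x y t. f x y t + g x y t)"
| mult: "elementary b f \<Longrightarrow> elementary b g \<Longrightarrow> elementary b (\<lambda>x y t. f x y t * g x y t)"

lemma elementary_continuous:
  assumes "elementary b f" "\<And>t. t \<in> J \<Longrightarrow> 0 < 1 + b * t"
  shows "continuous_on (A \<times> B \<times> J) (\<lambda>(x, y, t). f x y t)"
  using assms(1)
proof induction
  case inverse
  show ?case using assms(2) unfolding case_prod_unfold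
    by (intro continuous_intros) (force dest: assms(2))
next
  case ln
  show ?case using assms(2) unfolding case_prod_unfold
    by (intro continuous_intros) (force dest: assms(2))
next
  case (add f g)
  then show ?case unfolding case_prod_unfold by (intro continuous_on_add)
next
  case (mult f g)
  then show ?case unfolding case_prod_unfold by (intro continuous_on_mult)
qed (auto simp: case_prod_unfold intro!: continuous_on_fst continuous_on_snd continuous_on_id)

lemma elementary_dx:
  assumes "elementary b f"
  shows "\<exists>f'. elementary b f' \<and>
    (\<forall>x y t. ((\<lambda>s. f s y t) has_real_derivative f' x y t) (at x within A))"
  using assms
proof induction
  case x
  show ?case by (rule exI[of _ "\<lambda>x y t. 1"]) (simp add: elementary.const)
next
  case (add f g)
  then obtain f' g' where "elementary b f'" "elementary b g'"
    "\<And>x y t. ((\<lambda>s. f s y t) has_real_derivative f' x y t) (at x within A)"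
    "\<And>x y t. ((\<lambda>s. g s y t) has_real_derivative g' x y t) (at x within A)" by blast
  then show ?case
    by (intro exI[of _ "\<lambda>x y t. f' x y t + g' x y t"])
      (auto intro!: elementary.intros derivative_intros)
next
  case (mult f g)
  then obtain f' g' where "elementary b f'" "elementary b g'"
    "\<And>x y t. ((\<lambda>s. f s y t) has_real_derivative f' x y t) (at x within A)"
    "\<And>x y t. ((\<lambda>s. g s y t) has_real_derivative g' x y t) (at x within A)" by blast
  with mult.hyps show ?case
    by (intro exI[of _ "\<lambda>x y t. f' x y t * g x y t + g' x y t * f x y t"])
      (auto intro!: elementary.intros DERIV_mult)
qed (rule exI[of _ "\<lambda>x y t. 0"], simp add: elementary.const)+

lemma elementary_swap:
  assumes "elementary b f"
  shows "elementary b (\<lambda>x y t. f y x t)"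
  using assms by induction (simp_all add: elementary.intros)

lemma elementary_dy:
  assumes "elementary b f"
  shows "\<exists>f'. elementary b f' \<and>
    (\<forall>x y t. ((\<lambda>s. f x s t) has_real_derivative f' x y t) (at y within A))"
proof -
  obtain f' where "elementary b f'"
    "\<And>x y t. ((\<lambda>s. f y s t) has_real_derivative f' x y t) (at x within A)"
    using elementary_dx[OF elementary_swap[OF assms]] by blast
  then show ?thesis
    by (intro exI[of _ "\<lambda>x y t. f' y x t"]) (auto intro: elementary_swap)
qed

lemma elementary_dt:
  assumes "elementary b f" "\<And>t. t \<in> J \<Longrightarrow> 0 < 1 + b * t"
  shows "\<exists>f'. elementary b f' \<and>
    (\<forall>x y. \<forall>t\<in>J. ((\<lambda>s. f x y s) has_real_derivative f' x y t) (at t within J))"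
  using assms(1)
proof induction
  case inverse
  show ?case
  proof (intro exI conjI allI ballI)
    show "elementary b (\<lambda>x y t. (- b) * (inverse (1 + b * t) * inverse (1 + b * t)))"
      by (intro elementary.intros)
    fix t assume "t \<in> J"
    then show "((\<lambda>s. inverse (1 + b * s)) has_real_derivative
        (- b) * (inverse (1 + b * t) * inverse (1 + b * t))) (at t within J)"
      using assms(2)[of t] by (auto intro!: derivative_eq_intros)
  qed
next
  case ln
  show ?case
  proof (intro exI conjI allI ballI)
    show "elementary b (\<lambda>x y t. b * inverse (1 + b * t))"
      by (intro elementary.intros)
    fix t assume "t \<in> J"
    then show "((\<lambda>s. ln (1 + b * s)) has_real_derivative b * inverse (1 + b * t)) (at t within J)"
      using assms(2)[of t] by (auto intro!: derivative_eq_intros simp: divide_inverse)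
  qed
next
  case (add f g)
  then obtain f' g' where "elementary b f'" "elementary b g'"
    "\<And>x y t. t \<in> J \<Longrightarrow> ((\<lambda>s. f x y s) has_real_derivative f' x y t) (at t within J)"
    "\<And>x y t. t \<in> J \<Longrightarrow> ((\<lambda>s. g x y s) has_real_derivative g' x y t) (at t within J)" by blast
  then show ?case
    by (intro exI[of _ "\<lambda>x y t. f' x y t + g' x y t"])
      (auto intro!: elementary.intros derivative_intros)
next
  case (mult f g)
  then obtain f' g' where "elementary b f'" "elementary b g'"
    "\<And>x y t. t \<in> J \<Longrightarrow> ((\<lambda>s. f x y s) has_real_derivative f' x y t) (at t within J)"
    "\<And>x y t. t \<in> J \<Longrightarrow> ((\<lambda>s. g x y s) has_real_derivative g' x y t) (at t within J)" by blast
  with mult.hyps show ?case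
    by (intro exI[of _ "\<lambda>x y t. f' x y t * g x y t + g' x y t * f x y t"])
      (auto intro!: elementary.intros DERIV_mult)
qed (rule exI[of _ "\<lambda>x y t. 0"], simp add: elementary.const)+

text \<open>
  The induction on \<open>k\<close> needs agreement on the domain instead of equality with an elementary
  function, because \<open>dx u\<close>, \<open>dy u\<close> and \<open>dt J u\<close> can be unspecified at points outside of the domain.
\<close>

lemma Ck_elementary:
  assumes J: "\<And>t. t \<in> J \<Longrightarrow> 0 < 1 + b * t" "\<And>t. t \<in> J \<Longrightarrow> t islimpt J"
    and f: "elementary b f"
    and u: "\<And>x y t. x \<in> {0..1} \<Longrightarrow> y \<in> {0..1} \<Longrightarrow> t \<in> J \<Longrightarrow> u x y t = f x y t"
  shows "Ck J k u"
proof -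
  have cont: "continuous_on ({0..1} \<times> {0..1} \<times> J) (\<lambda>(x, y, t). u x y t)"
    if "elementary b f"
      and "\<And>x y t. x \<in> {0..1} \<Longrightarrow> y \<in> {0..1} \<Longrightarrow> t \<in> J \<Longrightarrow> u x y t = f x y t" for f u
  proof -
    have "continuous_on ({0..1} \<times> {0..1} \<times> J) (\<lambda>(x, y, t). f x y t)"
      by (intro elementary_continuous[OF that(1)] J)
    then show ?thesis
      using that(2)
      by (subst continuous_on_cong[OF refl, where g = "\<lambda>(x, y, t). f x y t"]) auto
  qed
  show ?thesis
    using f u
  proof (induction k arbitrary: f u)
    case (0 f u)
    then show ?case by (simp only: Ck.simps cont)
  next
    case (Suc k f u)
    obtain fx where fx: "elementary b fx"
      "\<And>x y t. ((\<lambda>s. f s y t) has_real_derivative fx x y t) (at x within {0..1})"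
      using elementary_dx[OF Suc.prems(1)] by blast
    obtain fy where fy: "elementary b fy"
      "\<And>x y t. ((\<lambda>s. f x s t) has_real_derivative fy x y t) (at y within {0..1})"
      using elementary_dy[OF Suc.prems(1)] by blast
    obtain ft where ft: "elementary b ft"
      "\<And>x y t. t \<in> J \<Longrightarrow> ((\<lambda>s. f x y s) has_real_derivative ft x y t) (at t within J)"
    proof -
      have "\<exists>f'. elementary b f' \<and>
          (\<forall>x y. \<forall>t\<in>J. ((\<lambda>s. f x y s) has_real_derivative f' x y t) (at t within J))"
        by (rule elementary_dt[OF Suc.prems(1)]) (rule J(1))
      then show ?thesis using that by blast
    qed
    have "Ck J k (dx u)"
      using Suc.prems(2) by (intro Suc.IH[OF fx(1)] dx_eqI[OF _ fx(2)]) auto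
    moreover have "Ck J k (dy u)"
      using Suc.prems(2) by (intro Suc.IH[OF fy(1)] dy_eqI[OF _ fy(2)]) auto
    moreover have "Ck J k (dt J u)"
      using Suc.prems(2) J(2) by (intro Suc.IH[OF ft(1)] dt_eqI[OF _ ft(2)]) auto
    moreover have "(\<lambda>s. u s y t) differentiable (at x within {0..1}) \<and>
        (\<lambda>s. u x s t) differentiable (at y within {0..1}) \<and>
        (\<lambda>s. u x y s) differentiable (at t within J)"
      if "x \<in> {0..1}" "y \<in> {0..1}" "t \<in> J" for x y t
    proof (intro conjI)
      have "((\<lambda>s. u s y t) has_real_derivative fx x y t) (at x within {0..1})"
        using that Suc.prems(2) by (intro has_real_derivative_within_cong[OF fx(2)]) auto
      then show "(\<lambda>s. u s y t) differentiable (at x within {0..1})"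
        unfolding real_differentiable_def by blast
      have "((\<lambda>s. u x s t) has_real_derivative fy x y t) (at y within {0..1})"
        using that Suc.prems(2) by (intro has_real_derivative_within_cong[OF fy(2)]) auto
      then show "(\<lambda>s. u x s t) differentiable (at y within {0..1})"
        unfolding real_differentiable_def by blast
      have "((\<lambda>s. u x y s) has_real_derivative ft x y t) (at t within J)"
        using that Suc.prems(2) by (intro has_real_derivative_within_cong[OF ft(2)]) auto
      then show "(\<lambda>s. u x y s) differentiable (at t within J)"
        unfolding real_differentiable_def by blast
    qed
    ultimately show ?case
      using cont[OF Suc.prems] by simp
  qed
qed

section \<open>The explicit solution\<close>

lemma explicit_solution:
  fixes a :: real
  defines "u \<equiv> \<lambda>x y t. a / (1 + 12 * a * t) * x^2 * y^2 - 2 / 3 * ln (1 + 12 * a * t)"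
  assumes J: "\<And>t. t \<in> J \<Longrightarrow> 0 < 1 + 12 * a * t" "\<And>t. t \<in> J \<Longrightarrow> t islimpt J"
  shows "solution_on J u"
proof -
  define c where "c t = a / (1 + 12 * a * t)" for t
  have u_c: "u x y t = c t * x^2 * y^2 - 2 / 3 * ln (1 + 12 * a * t)" for x y t
    by (simp add: u_def c_def)
  have elem: "elementary (12 * a) (\<lambda>x y t. (a * inverse (1 + (12 * a) * t)) * ((x * x) * (y * y))
      + (- 2 / 3) * ln (1 + (12 * a) * t))"
    by (intro elementary.intros)
  have "Ck J k u" for k
  proof (rule Ck_elementary[OF _ J(2) elem])
    show "u x y t = (a * inverse (1 + (12 * a) * t)) * ((x * x) * (y * y))
        + (- 2 / 3) * ln (1 + (12 * a) * t)" for x y t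
      by (simp add: u_def divide_inverse[of a] power2_eq_square mult.assoc)
  qed (use J(1) in simp_all)
  then have smooth: "smooth J u"
    unfolding smooth_def by blast
  have x1: "dx u x y t = 2 * c t * x * y^2" if "x \<in> {0..1}" for x y t
    by (rule dx_eqI, rule u_c) (use that in \<open>auto intro!: derivative_eq_intros\<close>)
  have x2: "dx (dx u) x y t = 2 * c t * y^2" if "x \<in> {0..1}" for x y t
    by (rule dx_eqI, erule x1) (use that in \<open>auto intro!: derivative_eq_intros\<close>)
  have x3: "dx (dx (dx u)) x y t = 0" if "x \<in> {0..1}" for x y t
    by (rule dx_eqI, erule x2) (use that in \<open>auto intro!: derivative_eq_intros\<close>)
  have x4: "dx (dx (dx (dx u))) x y t = 0" if "x \<in> {0..1}" for x y t
    by (rule dx_eqI, erule x3) (use that in \<open>auto intro!: derivative_eq_intros\<close>)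
  have y1: "dy u x y t = 2 * c t * x^2 * y" if "y \<in> {0..1}" for x y t
    by (rule dy_eqI, rule u_c) (use that in \<open>auto intro!: derivative_eq_intros\<close>)
  have y2: "dy (dy u) x y t = 2 * c t * x^2" if "y \<in> {0..1}" for x y t
    by (rule dy_eqI, erule y1) (use that in \<open>auto intro!: derivative_eq_intros\<close>)
  have y3: "dy (dy (dy u)) x y t = 0" if "y \<in> {0..1}" for x y t
    by (rule dy_eqI, erule y2) (use that in \<open>auto intro!: derivative_eq_intros\<close>)
  have y4: "dy (dy (dy (dy u))) x y t = 0" if "y \<in> {0..1}" for x y t
    by (rule dy_eqI, erule y3) (use that in \<open>auto intro!: derivative_eq_intros\<close>)
  have yx: "dy (dx u) x y t = 4 * c t * x * y" if "x \<in> {0..1}" "y \<in> {0..1}" for x y t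
    by (rule dy_eqI, rule x1[OF that(1)]) (use that in \<open>auto intro!: derivative_eq_intros\<close>)
  have xy: "dx (dy u) x y t = 4 * c t * x * y" if "x \<in> {0..1}" "y \<in> {0..1}" for x y t
    by (rule dx_eqI, rule y1[OF that(2)]) (use that in \<open>auto intro!: derivative_eq_intros\<close>)
  have yxx: "dy (dx (dx u)) x y t = 4 * c t * y" if "x \<in> {0..1}" "y \<in> {0..1}" for x y t
    by (rule dy_eqI, rule x2[OF that(1)]) (use that in \<open>auto intro!: derivative_eq_intros\<close>)
  have yyxx: "dy (dy (dx (dx u))) x y t = 4 * c t" if "x \<in> {0..1}" "y \<in> {0..1}" for x y t
    by (rule dy_eqI, rule yxx[OF that(1)], assumption)
      (use that in \<open>auto intro!: derivative_eq_intros\<close>)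
  have ut: "dt J u x y t = - 12 * (c t)^2 * x^2 * y^2 - 8 * c t" if "t \<in> J" for x y t
  proof (rule dt_eqI[OF _ _ that J(2)[OF that]])
    show "u x y s = c s * x^2 * y^2 - 2 / 3 * ln (1 + 12 * a * s)" for s by (rule u_c)
    have w: "1 + 12 * a * t \<noteq> 0" using J(1)[OF that] by simp
    have "(c has_real_derivative - (a * (12 * a)) / (1 + 12 * a * t)^2) (at t within J)"
      unfolding c_def using w by (auto intro!: derivative_eq_intros simp: power2_eq_square)
    then have "(c has_real_derivative - 12 * (c t)^2) (at t within J)"
      by (simp add: c_def power_divide power2_eq_square mult_ac)
    moreover have "((\<lambda>s. ln (1 + 12 * a * s)) has_real_derivative 12 * c t) (at t within J)"
      using J(1)[OF that] by (auto intro!: derivative_eq_intros simp: c_def)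
    ultimately have "((\<lambda>s. c s * (x^2 * y^2) - 2 / 3 * ln (1 + 12 * a * s))
        has_real_derivative - 12 * (c t)^2 * (x^2 * y^2) - 2 / 3 * (12 * c t)) (at t within J)"
      by (intro DERIV_diff DERIV_cmult DERIV_cmult_right)
    then show "((\<lambda>s. c s * x^2 * y^2 - 2 / 3 * ln (1 + 12 * a * s))
        has_real_derivative - 12 * (c t)^2 * x^2 * y^2 - 8 * c t) (at t within J)"
      by (simp add: mult.assoc)
  qed
  have pde: "dt J u x y t = det (hessian u x y t) - bilaplacian u x y t"
    if "x \<in> {0..1}" "y \<in> {0..1}" "t \<in> J" for x y t
    using that
    by (simp add: ut hessian_def bilaplacian_def det_2 x2 x4 y2 y4 xy yx yyxx numeral_eq_Suc)
  have "boundary_conditions J u"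
    unfolding boundary_conditions_def
    by (simp add: numeral_eq_Suc x1 x2 x3 y1 y2 y3)
  then show ?thesis
    unfolding solution_on_def using smooth pde by blast
qed

section \<open>Blow-up\<close>

lemma blows_up_at_if_pointwise:
  assumes "0 < T" "solution_on {t. 0 \<le> t \<and> ereal t < T} u"
    and "x \<in> {0..1}" "y \<in> {0..1}" "filterlim (\<lambda>t. \<bar>u x y t\<bar>) at_top (upto_time T)"
  shows "blows_up_at T u"
proof -
  have "((\<lambda>t. ereal \<bar>u x y t\<bar>) \<longlongrightarrow> \<infinity>) (upto_time T)"
    using assms(5) by (simp add: tendsto_PInfty_eq_at_top)
  moreover have "ereal \<bar>u x y t\<bar> \<le> (SUP (x, y)\<in>{0..1} \<times> {0..1}. ereal \<bar>u x y t\<bar>)" for t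
    using assms(3,4) by (intro SUP_upper2[of "(x, y)"]) auto
  ultimately have "((\<lambda>t. SUP (x, y)\<in>{0..1} \<times> {0..1}. ereal \<bar>u x y t\<bar>) \<longlongrightarrow> \<infinity>) (upto_time T)"
    unfolding tendsto_PInfty by (metis (no_types, lifting) eventually_mono less_le_trans)
  then show ?thesis
    unfolding blows_up_at_def using assms(1,2) by blast
qed

lemma complete_blow_up_atI:
  assumes "0 < T" "solution_on {t. 0 \<le> t \<and> ereal t < T} u"
    and "\<And>x y. x \<in> {0..1} \<Longrightarrow> y \<in> {0..1} \<Longrightarrow>
      filterlim (u x y) at_top (upto_time T) \<or> filterlim (u x y) at_bot (upto_time T)"
  shows "complete_blow_up_at T u"
proof -
  have abs: "filterlim (\<lambda>t. \<bar>u x y t\<bar>) at_top (upto_time T)" if "x \<in> {0..1}" "y \<in> {0..1}" for x y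
    using assms(3)[OF that]
    by (auto intro: filterlim_compose[OF filterlim_abs_real]
        filterlim_at_infinity_imp_norm_at_top[of "u x y", unfolded real_norm_def]
        filterlim_mono[OF _ at_bot_le_at_infinity order_refl])
  then show ?thesis
    unfolding complete_blow_up_at_def
    using blows_up_at_if_pointwise[OF assms(1,2), of 0 0] by auto
qed

theorem mainTheorem1:
  fixes a\<^sub>0 :: real and u :: "real \<Rightarrow> real \<Rightarrow> real \<Rightarrow> real"
  assumes u_eq: "u = (\<lambda>x y t. a\<^sub>0 / (1 + 12 * a\<^sub>0 * t) * x^2 * y^2 - 2 / 3 * ln (1 + 12 * a\<^sub>0 * t))"
  shows "solution_on {t. 0 \<le> t \<and> 0 < 1 + 12 * a\<^sub>0 * t} u \<and>
    (a\<^sub>0 = 0 \<longrightarrow>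
      solution_on {0..} u \<and> (\<forall>x\<in>{0..1}. \<forall>y\<in>{0..1}. \<forall>t\<ge>0. u x y t = 0)) \<and>
    (a\<^sub>0 > 0 \<longrightarrow>
      {t. 0 \<le> t \<and> 0 < 1 + 12 * a\<^sub>0 * t} = {0..} \<and>
      solution_on {0..} u \<and>
      blows_up_at \<infinity> u \<and>
      (\<forall>x\<in>{0..1}. \<forall>y\<in>{0..1}. filterlim (\<lambda>t. u x y t) at_bot at_top) \<and>
      complete_blow_up_at \<infinity> u) \<and>
    (a\<^sub>0 < 0 \<longrightarrow>
      {t. 0 \<le> t \<and> 0 < 1 + 12 * a\<^sub>0 * t} = {0..<- 1 / (12 * a\<^sub>0)} \<and>
      solution_on {0..<- 1 / (12 * a\<^sub>0)} u \<and>
      blows_up_at (ereal (- 1 / (12 * a\<^sub>0))) u \<and>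
      (\<forall>x\<in>{0..1}. \<forall>y\<in>{0..1}. x = 0 \<or> y = 0 \<longrightarrow>
         filterlim (\<lambda>t. u x y t) at_top (at_left (- 1 / (12 * a\<^sub>0)))) \<and>
      (\<forall>x\<in>{0..1}. \<forall>y\<in>{0..1}. \<not> (x = 0 \<or> y = 0) \<longrightarrow>
         filterlim (\<lambda>t. u x y t) at_bot (at_left (- 1 / (12 * a\<^sub>0)))) \<and>
      complete_blow_up_at (ereal (- 1 / (12 * a\<^sub>0))) u)"
proof -
  let ?J = "{t. 0 \<le> t \<and> 0 < 1 + 12 * a\<^sub>0 * t}" and ?T = "- 1 / (12 * a\<^sub>0)"
  have J_nonneg: "?J = {0..}" if "a\<^sub>0 \<ge> 0"
    using that by (auto simp: add_pos_nonneg)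
  have J_neg: "?J = {0..<?T}" if "a\<^sub>0 < 0"
    using that by (auto simp: field_simps)
  have T_pos: "0 < ?T" if "a\<^sub>0 < 0"
    using that by (simp add: divide_neg_neg)
  \<comment> \<open>A limit point is needed for the time derivative within the interval to be determined.\<close>
  have limpt: "t islimpt ?J" if "t \<in> ?J" for t
  proof (cases "a\<^sub>0 < 0")
    case True
    have "connected ?J" unfolding J_neg[OF True] by simp
    moreover have "0 \<in> ?J" "?T / 2 \<in> ?J" "?T / 2 \<noteq> 0"
      using True by auto
    ultimately show ?thesis
      using that by (intro connected_imp_islimpt[of ?J t])
  next
    case False
    then have J: "?J = {0..}" by (intro J_nonneg) simp
    have "0 \<in> ?J" "1 \<in> ?J" "0 \<noteq> (1::real)" using False by auto
    moreover have "connected ?J" unfolding J by simp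
    ultimately show ?thesis
      using that by (intro connected_imp_islimpt[of ?J t])
  qed
  have sol: "solution_on ?J u"
    unfolding u_eq using limpt by (intro explicit_solution) auto
  have zero: "solution_on {0..} u \<and> (\<forall>x\<in>{0..1}. \<forall>y\<in>{0..1}. \<forall>t\<ge>0. u x y t = 0)" if "a\<^sub>0 = 0"
    using sol that J_nonneg by (auto simp: u_eq)
  have pos: "solution_on {0..} u \<and> blows_up_at \<infinity> u \<and>
      (\<forall>x\<in>{0..1}. \<forall>y\<in>{0..1}. filterlim (\<lambda>t. u x y t) at_bot at_top) \<and>
      complete_blow_up_at \<infinity> u" if a: "a\<^sub>0 > 0"
  proof -
    have bot: "filterlim (u x y) at_bot at_top" for x y
      unfolding u_eq using a by real_asymp
    have sol': "solution_on {0..} u" using sol J_nonneg a by simp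
    then have "complete_blow_up_at \<infinity> u"
      using bot by (intro complete_blow_up_atI) (auto simp: upto_time_def atLeast_def)
    then show ?thesis
      using bot sol' by (simp add: complete_blow_up_at_def)
  qed
  have neg: "solution_on {0..<?T} u \<and> blows_up_at (ereal ?T) u \<and>
      (\<forall>x\<in>{0..1}. \<forall>y\<in>{0..1}. x = 0 \<or> y = 0 \<longrightarrow> filterlim (\<lambda>t. u x y t) at_top (at_left ?T)) \<and>
      (\<forall>x\<in>{0..1}. \<forall>y\<in>{0..1}. \<not> (x = 0 \<or> y = 0) \<longrightarrow>
         filterlim (\<lambda>t. u x y t) at_bot (at_left ?T)) \<and>
      complete_blow_up_at (ereal ?T) u" if a: "a\<^sub>0 < 0"
  proof -
    have w: "filterlim (\<lambda>t. 1 + 12 * a\<^sub>0 * t) (at_right 0) (at_left ?T)"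
    proof -
      have "((\<lambda>t. 1 + 12 * a\<^sub>0 * t) \<longlongrightarrow> 1 + 12 * a\<^sub>0 * ?T) (at_left ?T)"
        by (intro tendsto_intros)
      moreover have "\<forall>\<^sub>F t in at_left ?T. 1 + 12 * a\<^sub>0 * t \<in> {0<..}"
      proof (rule eventually_mono)
        show "\<forall>\<^sub>F t in at_left ?T. t < ?T" by (simp add: eventually_at_filter)
      qed (use a in \<open>simp add: field_simps\<close>)
      ultimately show ?thesis
        using a by (auto simp: filterlim_at elim!: eventually_mono)
    qed
    have top: "filterlim (u x y) at_top (at_left ?T)" if "x = 0 \<or> y = 0" for x y
    proof -
      \<comment> \<open>The substitution \<open>w = 1 + 12 a\<^sub>0 t\<close> leaves a limit without parameters.\<close>
      have "filterlim (\<lambda>w::real. - (2 / 3 * ln w)) at_top (at_right 0)" by real_asymp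
      from filterlim_compose[OF this w] show ?thesis using that by (auto simp: u_eq)
    qed
    have bot: "filterlim (u x y) at_bot (at_left ?T)" if "\<not> (x = 0 \<or> y = 0)" for x y
    proof -
      define k where "k = a\<^sub>0 * (x^2 * y^2)"
      have "k < 0" using a that by (simp add: k_def mult_neg_pos)
      then have "filterlim (\<lambda>w. k / w - 2 / 3 * ln w) at_bot (at_right 0)" by real_asymp
      from filterlim_compose[OF this w] show ?thesis by (simp add: u_eq k_def mult.assoc)
    qed
    have J_eq: "{t. 0 \<le> t \<and> ereal t < ereal ?T} = {0..<?T}" by auto
    have sol': "solution_on {0..<?T} u" using sol J_neg a by simp
    have "complete_blow_up_at (ereal ?T) u"
    proof (rule complete_blow_up_atI)
      show "0 < ereal ?T" using T_pos[OF a] by simp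
      show "solution_on {t. 0 \<le> t \<and> ereal t < ereal ?T} u" unfolding J_eq by (fact sol')
      show "filterlim (u x y) at_top (upto_time (ereal ?T)) \<or>
          filterlim (u x y) at_bot (upto_time (ereal ?T))" for x y
        using top[of x y] bot[of x y] by (auto simp: upto_time_def)
    qed
    then show ?thesis
      using top bot sol' by (simp add: complete_blow_up_at_def)
  qed
  show ?thesis
    using sol zero pos neg J_nonneg J_neg by (intro conjI impI) simp_all
qed

end
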